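(* Let $X$ be a finite-dimensional, strictly convex and smooth real Banach space and let $M, N\subset X$ be linear subspaces. The following assertions are equivalent. (i) $R_{M,N}=R_{N,M}=P_{M\cap N}$. (ii) $P_{M\cap N} P_M = P_{M\cap N}$ and $P_{M\cap N} P_N = P_{M\cap N}$. (iii) $P_M(\ker P_{M\cap N}) \subset \ker P_{M\cap N}$ and $P_N(\ker P_{M\cap N}) \subset \ker P_{M\cap N}$. (iv) $R_{M,N}$ and $R_{N,M}$ are $B$-operators.
   Context: For a finite-dimensional strictly convex Banach space $X$ and a linear subspace $L\subset X$, the metric projection $P_L\colon X\to X$ sends $x$ to the unique point $P_Lx\in L$ with $\|x-P_Lx\|=d(x,L)$; it is in general nonlinear. For a map $P\colon X\to X$, $\ker P:=\{x\in X: Px=0\}$. When $X$ is finite-dimensional, strictly convex and smooth (the norm is Gâteaux differentiable away from the origin), the alternating projections converge pointwise, and one defines $R_{M,N}x:=\lim_{n\to\infty}(P_MP_N)^nx$ and $R_{N,M}x:=\lim_{n\to\infty}(P_NP_M)^nx$ for $x\in X$; both limits lie in $M\cap N$. A map $P\colon X\to X$ is called a $B$-operator if (1) $\|x-Px\|\le\|x\|$ for all $x\in X$, and (2) $\|x-Px\|=\|x\|$ if and only if $Px=0$. *)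

theory Defs
  imports "HOL-Analysis.Analysis"
begin

text \<open>The Banach space is a type of class \<open>banach\<close>; the properties of the whole
  space are predicates on the type.\<close>

definition finite_dimensional_space :: "'a::real_vector itself \<Rightarrow> bool" where
  "finite_dimensional_space _ \<longleftrightarrow> (\<exists>B :: 'a set. finite B \<and> span B = UNIV)"

definition strictly_convex_space :: "'a::real_normed_vector itself \<Rightarrow> bool" where
  "strictly_convex_space _ \<longleftrightarrow>
     (\<forall>x y :: 'a. norm x = 1 \<and> norm y = 1 \<and> x \<noteq> y \<longrightarrow> norm ((1/2) *\<^sub>R (x + y)) < 1)"

definition gateaux_differentiable_at :: "('a::real_normed_vector \<Rightarrow> real) \<Rightarrow> 'a \<Rightarrow> bool" where
  "gateaux_differentiable_at f x \<longleftrightarrow>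
     (\<exists>D. bounded_linear D \<and>
       (\<forall>h. ((\<lambda>t::real. (f (x + t *\<^sub>R h) - f x) / t) \<longlongrightarrow> D h) (at 0)))"

definition smooth_space :: "'a::real_normed_vector itself \<Rightarrow> bool" where
  "smooth_space _ \<longleftrightarrow> (\<forall>x :: 'a. x \<noteq> 0 \<longrightarrow> gateaux_differentiable_at norm x)"

text \<open>The library's \<open>closest_point\<close> requires an inner product. The description below
  is proper whenever the nearest point exists and is unique, which holds for linear
  subspaces of finite-dimensional strictly convex spaces.\<close>

definition metric_proj :: "'a::real_normed_vector set \<Rightarrow> 'a \<Rightarrow> 'a" where
  "metric_proj L x = (THE p. p \<in> L \<and> norm (x - p) = infdist x L)"

text \<open>\<open>lim\<close> is meaningful only for convergent sequences; in finite-dimensional, strictly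
  convex, smooth spaces the alternating projections onto linear subspaces do converge.\<close>

definition alt_proj_lim :: "'a::real_normed_vector set \<Rightarrow> 'a set \<Rightarrow> 'a \<Rightarrow> 'a" where
  "alt_proj_lim M N x = lim (\<lambda>n. ((metric_proj M \<circ> metric_proj N) ^^ n) x)"

definition op_ker :: "('a \<Rightarrow> 'a::zero) \<Rightarrow> 'a set" where
  "op_ker P = {x. P x = 0}"

definition B_operator :: "('a::real_normed_vector \<Rightarrow> 'a) \<Rightarrow> bool" where
  "B_operator P \<longleftrightarrow>
     (\<forall>x. norm (x - P x) \<le> norm x) \<and> (\<forall>x. norm (x - P x) = norm x \<longleftrightarrow> P x = 0)"

end

theory Submission imports Defs begin

text \<open>
  Write \<open>P\<^sub>L\<close> for the metric projection onto \<open>L\<close> and put \<open>P = P\<^sub>M\<^sub>\<inter>\<^sub>N\<close>.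

  The analytic heart is a uniform contraction of the gaps \<open>\<parallel>z - P\<^sub>N z\<parallel>\<close> along the alternating
  projections (lemma \<open>gap_contraction\<close>). A gap vector \<open>y = z - P\<^sub>N z\<close> with \<open>z \<in> M\<close> lies in
  \<open>M + N\<close> and has 0 as a nearest point in \<open>N\<close>. If 0 were nearest in \<open>M\<close> as well, the derivative
  of the norm at \<open>y\<close> would vanish on \<open>M\<close> and on \<open>N\<close>, hence at \<open>y\<close> itself, where its value is
  \<open>\<parallel>y\<parallel>\<close>. So the next gap is strictly shorter, and compactness of the unit sphere makes
  the ratio uniform. Gaps therefore decay geometrically, the iterates \<open>z\<^sub>n\<close> form a Cauchy
  sequence, and \<open>P\<^sub>N z\<^sub>n\<close> has the same limit, which must lie in \<open>M \<inter> N\<close>.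

  The equivalences are then formal. If \<open>P\<close> is unchanged by composition with \<open>P\<^sub>M\<close> and \<open>P\<^sub>N\<close>, it
  is constant along the iterates, so the common value must be their limit. Conversely,
  the iterates of \<open>P\<^sub>N P\<^sub>M\<close> from \<open>x\<close> and those of \<open>P\<^sub>M P\<^sub>N\<close> from \<open>P\<^sub>M x\<close> interleave to a single
  convergent sequence, so \<open>R\<^sub>M\<^sub>,\<^sub>N \<circ> P\<^sub>M = R\<^sub>N\<^sub>,\<^sub>M\<close>, which turns (i) into (ii). A metric projection
  onto a subspace is a \<open>B\<close>-operator because 0 competes with the nearest point, whence (iv). All operators involved commute with
  translation by vectors of \<open>M \<inter> N\<close>; this lets one move any point into the kernel of \<open>P\<close>
  ((iii) to (ii)), and it makes a \<open>B\<close>-operator among the limits the nearest-point map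
  onto \<open>M \<inter> N\<close> ((iv) to (i)).
\<close>

section \<open>Compactness in finite-dimensional normed spaces\<close>

lemma closed_if_compact_Int_cball:
  fixes S :: "'a::real_normed_vector set"
  assumes "\<And>r. compact (cball 0 r \<inter> S)"
  shows "closed S"
proof (unfold closed_sequential_limits, intro allI impI, elim conjE)
  fix f l assume f: "\<forall>n. f n \<in> S" and lim: "f \<longlonglongrightarrow> l"
  have "bounded (range f)"
    using lim by (simp add: convergent_imp_bounded)
  then obtain r where r: "\<And>n. norm (f n) \<le> r"
    by (auto simp: bounded_iff)
  have "closed (cball 0 r \<inter> S)"
    using assms by (rule compact_imp_closed)
  then show "l \<in> S"
    using f r lim by (auto dest!: closed_sequentially[of _ f l])
qed

text \<open>Induction on the spanning set. Adjoining \<open>b\<close> outside the closed span of \<open>B\<close>, the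
  coefficient of \<open>b\<close> in a vector of norm at most \<open>r\<close> is bounded because \<open>b\<close> has positive
  distance from that span; the ball is thus covered by the image of a compact product.\<close>

lemma compact_cball_Int_span:
  fixes B :: "'a::real_normed_vector set"
  assumes "finite B"
  shows "compact (cball 0 r \<inter> span B)"
  using assms
proof (induction B arbitrary: r rule: finite_induct)
  case empty
  show ?case by (rule finite_imp_compact) simp
next
  case (insert b B)
  have closed: "closed (span B)"
    using insert.IH by (rule closed_if_compact_Int_cball)
  show ?case
  proof (cases "b \<in> span B")
    case True
    then show ?thesis using insert.IH by (simp add: span_redundant)
  next
    case False
    define d where "d = infdist b (span B)"
    have d: "d > 0"
      using False closed span_zero[of B] unfolding d_def
      by (metis empty_iff in_closed_iff_infdist_zero infdist_nonneg less_eq_real_def)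
    define C where "C = r / d"
    define I where
      "I = (\<lambda>(a, y). a *\<^sub>R b + y) ` ({-C..C} \<times> (cball 0 (r + C * norm b) \<inter> span B))"
    have "compact I"
      unfolding I_def case_prod_unfold
      by (intro compact_continuous_image compact_Times insert.IH continuous_intros) simp
    moreover have "cball 0 r \<inter> span (insert b B) = cball 0 r \<inter> I"
    proof (intro equalityI subsetI)
      fix x assume x: "x \<in> cball 0 r \<inter> span (insert b B)"
      then obtain a where a: "x - a *\<^sub>R b \<in> span B"
        by (auto simp: span_breakdown_eq)
      have "\<bar>a\<bar> * d \<le> norm x"
      proof (cases "a = 0")
        case False
        have "b - (1/a) *\<^sub>R x = (-1/a) *\<^sub>R (x - a *\<^sub>R b)"
          using False by (simp add: algebra_simps)
        then have "b - (1/a) *\<^sub>R x \<in> span B"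
          using a by (metis span_scale)
        from infdist_le[OF this, of b] have "d \<le> norm x / \<bar>a\<bar>"
          by (simp add: d_def dist_norm)
        then show ?thesis
          using False by (simp add: field_simps)
      qed simp
      then have aC: "\<bar>a\<bar> \<le> C"
        using x d by (simp add: C_def field_simps)
      have "norm (x - a *\<^sub>R b) \<le> norm x + \<bar>a\<bar> * norm b"
        by (metis norm_scaleR norm_triangle_ineq4)
      also have "\<dots> \<le> r + C * norm b"
        using x aC by (intro add_mono mult_right_mono) auto
      finally have "(a, x - a *\<^sub>R b) \<in> {-C..C} \<times> (cball 0 (r + C * norm b) \<inter> span B)"
        using a aC by auto
      then have "x \<in> I"
        unfolding I_def by (rule rev_image_eqI) simp
      then show "x \<in> cball 0 r \<inter> I" using x by simp
    next
      fix x assume "x \<in> cball 0 r \<inter> I"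
      then obtain a y where "x = a *\<^sub>R b + y" "y \<in> span B" "x \<in> cball 0 r"
        by (auto simp: I_def)
      then show "x \<in> cball 0 r \<inter> span (insert b B)"
        by (auto simp: span_breakdown_eq intro!: exI[of _ a])
    qed
    ultimately show ?thesis
      by (simp add: closed_Int_compact)
  qed
qed

lemma finite_dimensional_compact_cball:
  assumes "finite_dimensional_space TYPE('a::real_normed_vector)"
  shows "compact (cball (0::'a) r)"
proof -
  obtain B :: "'a set" where "finite B" "span B = UNIV"
    using assms by (auto simp: finite_dimensional_space_def)
  then show ?thesis
    using compact_cball_Int_span[of B r] by simp
qed

lemma finite_dimensional_closed_subspace:
  fixes S :: "'a::real_normed_vector set"
  assumes "finite_dimensional_space TYPE('a)" "subspace S"
  shows "closed S"
proof -
  obtain E :: "'a set" where E: "finite E" "span E = UNIV"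
    using assms(1) by (auto simp: finite_dimensional_space_def)
  obtain B where B: "B \<subseteq> S" "independent B" "S \<subseteq> span B"
    by (rule maximal_independent_subset)
  have "finite B"
    using independent_span_bound[OF E(1) B(2)] E(2) by simp
  moreover have "span B = S"
    using B assms(2) by (intro antisym span_minimal) auto
  ultimately show ?thesis
    using closed_if_compact_Int_cball[of "span B"] compact_cball_Int_span by metis
qed

section \<open>Metric projections onto subspaces\<close>

lemma infdist_attained:
  fixes L :: "'a::real_normed_vector set"
  assumes "finite_dimensional_space TYPE('a)" "subspace L"
  shows "\<exists>p\<in>L. norm (x - p) = infdist x L"
proof -
  have "0 \<in> L" using assms(2) by (rule subspace_0)
  \<comment> \<open>Outside the ball of radius \<open>2 \<parallel>x\<parallel>\<close>, points are no closer to \<open>x\<close> than 0 is.\<close>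
  define K where "K = cball 0 (2 * norm x) \<inter> L"
  have "compact K"
    unfolding K_def using assms
    by (intro compact_Int_closed finite_dimensional_compact_cball finite_dimensional_closed_subspace)
  moreover have "0 \<in> K" using \<open>0 \<in> L\<close> by (simp add: K_def)
  ultimately obtain p where p: "p \<in> K" "\<And>q. q \<in> K \<Longrightarrow> norm (x - p) \<le> norm (x - q)"
    using continuous_attains_inf[of K "\<lambda>q. norm (x - q)"]
    by (force intro: continuous_intros)
  have "norm (x - p) \<le> norm (x - q)" if "q \<in> L" for q
  proof (cases "q \<in> K")
    case False
    then have "norm x \<le> norm (x - q)"
      using that norm_triangle_ineq2[of q x] by (simp add: K_def norm_minus_commute)
    then show ?thesis using p(2)[OF \<open>0 \<in> K\<close>] by simp
  qed (use p in auto)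
  then have "norm (x - p) \<le> infdist x L"
    using \<open>0 \<in> L\<close> by (auto simp: infdist_def dist_norm intro!: cINF_greatest)
  moreover have "infdist x L \<le> norm (x - p)"
    using p(1) infdist_le[of p L x] by (simp add: K_def dist_norm)
  ultimately show ?thesis using p(1) by (auto simp: K_def)
qed

text \<open>The midpoint of two distinct nearest points would be strictly nearer.\<close>

lemma nearest_point_unique:
  fixes L :: "'a::real_normed_vector set"
  assumes sc: "strictly_convex_space TYPE('a)" and L: "subspace L"
    and p: "p \<in> L" "norm (x - p) = infdist x L"
    and q: "q \<in> L" "norm (x - q) = infdist x L"
  shows "p = q"
proof (rule ccontr)
  assume neq: "p \<noteq> q"
  define d where "d = infdist x L"
  have "d \<noteq> 0" using neq p q by (auto simp: d_def)
  then have d: "d > 0" using infdist_nonneg[of x L] by (simp add: d_def)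
  let ?u = "(1/d) *\<^sub>R (x - p)" and ?v = "(1/d) *\<^sub>R (x - q)"
  have "norm ?u = 1" "norm ?v = 1" "?u \<noteq> ?v"
    using p q d neq by (auto simp: d_def)
  then have "norm ((1/2) *\<^sub>R (?u + ?v)) < 1"
    using sc[unfolded strictly_convex_space_def, rule_format, of ?u ?v] by blast
  moreover have "(1/2) *\<^sub>R (?u + ?v) = (1/d) *\<^sub>R (x - (1/2) *\<^sub>R (p + q))"
  proof -
    have "x = (1/2) *\<^sub>R x + (1/2) *\<^sub>R x"
      by (simp flip: scaleR_add_left)
    then have "x - (1/2) *\<^sub>R (p + q) = (1/2) *\<^sub>R ((x - p) + (x - q))"
      by (simp add: algebra_simps)
    then show ?thesis by (simp add: scaleR_add_right mult.commute)
  qed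
  ultimately have "\<bar>1/d\<bar> * norm (x - (1/2) *\<^sub>R (p + q)) < 1"
    by (simp only: norm_scaleR)
  then have "norm (x - (1/2) *\<^sub>R (p + q)) < d"
    using d by (simp add: pos_divide_less_eq del: scaleR_right_distrib scaleR_add_right)
  moreover have "(1/2) *\<^sub>R (p + q) \<in> L"
    using L p q by (intro subspace_scale subspace_add)
  ultimately show False
    using infdist_le[of "(1/2) *\<^sub>R (p + q)" L x] by (simp add: d_def dist_norm)
qed

lemma
  fixes L :: "'a::real_normed_vector set"
  assumes "finite_dimensional_space TYPE('a)" "strictly_convex_space TYPE('a)" "subspace L"
  shows metric_proj_in: "metric_proj L x \<in> L"
    and norm_diff_metric_proj: "norm (x - metric_proj L x) = infdist x L"
proof -
  have "\<exists>!p. p \<in> L \<and> norm (x - p) = infdist x L"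
    using infdist_attained[OF assms(1,3)] nearest_point_unique[OF assms(2,3)] by blast
  then have "metric_proj L x \<in> L \<and> norm (x - metric_proj L x) = infdist x L"
    unfolding metric_proj_def by (rule theI')
  then show "metric_proj L x \<in> L" "norm (x - metric_proj L x) = infdist x L" by auto
qed

lemma metric_proj_eqI:
  fixes L :: "'a::real_normed_vector set"
  assumes "finite_dimensional_space TYPE('a)" "strictly_convex_space TYPE('a)" "subspace L"
    and "p \<in> L" "\<And>q. q \<in> L \<Longrightarrow> norm (x - p) \<le> norm (x - q)"
  shows "metric_proj L x = p"
proof (rule nearest_point_unique[OF assms(2,3)])
  note proj = metric_proj_in[OF assms(1-3), of x] norm_diff_metric_proj[OF assms(1-3), of x]
  show "metric_proj L x \<in> L" "norm (x - metric_proj L x) = infdist x L" "p \<in> L"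
    using proj assms(4) by auto
  have "infdist x L \<le> norm (x - p)"
    using infdist_le[OF assms(4), of x] by (simp add: dist_norm)
  then show "norm (x - p) = infdist x L"
    using assms(5)[OF proj(1)] proj(2) by simp
qed

lemma metric_proj_best:
  fixes L :: "'a::real_normed_vector set"
  assumes "finite_dimensional_space TYPE('a)" "strictly_convex_space TYPE('a)" "subspace L"
    and "q \<in> L"
  shows "norm (x - metric_proj L x) \<le> norm (x - q)"
  using norm_diff_metric_proj[OF assms(1-3), of x] infdist_le[OF assms(4), of x]
  by (simp add: dist_norm)

lemma metric_proj_add:
  fixes L :: "'a::real_normed_vector set"
  assumes "finite_dimensional_space TYPE('a)" "strictly_convex_space TYPE('a)" "subspace L"
    and "w \<in> L"
  shows "metric_proj L (x + w) = metric_proj L x + w"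
proof (rule metric_proj_eqI[OF assms(1-3)])
  show "metric_proj L x + w \<in> L"
    using assms metric_proj_in by (intro subspace_add) auto
  fix q assume "q \<in> L"
  then have "q - w \<in> L" using assms by (intro subspace_diff)
  from metric_proj_best[OF assms(1-3) this, of x]
  show "norm (x + w - (metric_proj L x + w)) \<le> norm (x + w - q)"
    by (simp add: algebra_simps)
qed

lemma metric_proj_B_operator:
  fixes L :: "'a::real_normed_vector set"
  assumes "finite_dimensional_space TYPE('a)" "strictly_convex_space TYPE('a)" "subspace L"
  shows "B_operator (metric_proj L)"
  unfolding B_operator_def
proof (intro conjI allI iffI)
  fix x
  have 0: "0 \<in> L" using assms(3) by (rule subspace_0)
  show le: "norm (x - metric_proj L x) \<le> norm x" for x
    using metric_proj_best[OF assms 0, of x] by simp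
  assume eq: "norm (x - metric_proj L x) = norm x"
  show "metric_proj L x = 0"
  proof (rule metric_proj_eqI[OF assms 0])
    fix q assume "q \<in> L"
    from metric_proj_best[OF assms this, of x]
    show "norm (x - 0) \<le> norm (x - q)" using eq by simp
  qed
qed simp

section \<open>The contraction of gaps\<close>

text \<open>The derivative of the norm at \<open>y \<noteq> 0\<close> is the unique supporting functional there, and it
  annihilates every direction in which 0 is optimal: \<open>t \<mapsto> \<parallel>y + t h\<parallel>\<close> has a minimum at 0.\<close>

lemma smooth_nearest_zero_both:
  fixes M N :: "'a::real_normed_vector set"
  assumes smooth: "smooth_space TYPE('a)" and M: "subspace M" and N: "subspace N"
    and yM: "norm y \<le> infdist y M" and yN: "norm y \<le> infdist y N"
    and y: "y = u + v" "u \<in> M" "v \<in> N"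
  shows "y = 0"
proof (rule ccontr)
  assume "y \<noteq> 0"
  then obtain D where D: "bounded_linear D"
    and lim: "\<And>h. ((\<lambda>t::real. (norm (y + t *\<^sub>R h) - norm y) / t) \<longlongrightarrow> D h) (at 0)"
    using smooth by (auto simp: smooth_space_def gateaux_differentiable_at_def)
  interpret D: bounded_linear D by fact
  have zero: "D h = 0" if L: "subspace L" and yL: "norm y \<le> infdist y L" and h: "h \<in> L" for L h
  proof -
    have min: "norm y \<le> norm (y + t *\<^sub>R h)" for t
    proof -
      have "(- t) *\<^sub>R h \<in> L" using L h by (rule subspace_scale)
      from infdist_le[OF this, of y] yL show ?thesis by (simp add: dist_norm)
    qed
    have r: "((\<lambda>t. (norm (y + t *\<^sub>R h) - norm y) / t) \<longlongrightarrow> D h) (at_right 0)"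
      and l: "((\<lambda>t. (norm (y + t *\<^sub>R h) - norm y) / t) \<longlongrightarrow> D h) (at_left 0)"
      using lim[of h] by (auto simp: filterlim_at_split)
    have "D h \<ge> 0"
      using r by (rule tendsto_lowerbound)
        (auto simp: eventually_at_filter min intro!: always_eventually divide_nonneg_pos)
    moreover have "D h \<le> 0"
      using l by (rule tendsto_upperbound)
        (auto simp: eventually_at_filter min intro!: always_eventually divide_nonneg_neg)
    ultimately show ?thesis by simp
  qed
  have "D y = 0"
    using zero[OF M yM y(2)] zero[OF N yN y(3)] y(1) by (simp add: D.add)
  \<comment> \<open>By homogeneity of the norm, the derivative in the direction \<open>y\<close> is \<open>\<parallel>y\<parallel>\<close>.\<close>
  moreover have "D y = norm y"
  proof -
    have "\<forall>\<^sub>F t in at (0::real). (norm (y + t *\<^sub>R y) - norm y) / t = norm y"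
    proof -
      have "\<forall>\<^sub>F t in at (0::real). t \<in> {-1<..<1} - {0}"
        using eventually_at_in_open[of "{-1<..<1}" "0::real"] by simp
      then show ?thesis
      proof eventually_elim
        case (elim t)
        have "norm (y + t *\<^sub>R y) = norm ((1 + t) *\<^sub>R y)"
          by (simp add: scaleR_add_left)
        also have "\<dots> = (1 + t) * norm y" using elim by simp
        finally show ?case using elim by (simp add: field_simps)
      qed
    qed
    then have "((\<lambda>t::real. (norm (y + t *\<^sub>R y) - norm y) / t) \<longlongrightarrow> norm y) (at 0)"
      by (rule tendsto_eventually)
    with lim[of y] show ?thesis
      by (intro tendsto_unique[of "at (0::real)"]) auto
  qed
  ultimately show False using \<open>y \<noteq> 0\<close> by simp
qed

lemma infdist_scaleR_subspace:
  fixes L :: "'a::real_normed_vector set"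
  assumes "subspace L" "c \<noteq> 0"
  shows "infdist (c *\<^sub>R y) L \<le> \<bar>c\<bar> * infdist y L"
proof -
  have ne: "L \<noteq> {}" using subspace_0[OF assms(1)] by auto
  have "infdist (c *\<^sub>R y) L / \<bar>c\<bar> \<le> dist y a" if "a \<in> L" for a
  proof -
    have "infdist (c *\<^sub>R y) L \<le> norm (c *\<^sub>R (y - a))"
      using infdist_le[OF subspace_scale[OF assms(1) that, of c], of "c *\<^sub>R y"]
      by (simp add: dist_norm scaleR_diff_right)
    also have "\<dots> = \<bar>c\<bar> * dist y a" by (simp only: norm_scaleR dist_norm)
    finally show ?thesis using assms(2) by (simp add: field_simps)
  qed
  then have "infdist (c *\<^sub>R y) L / \<bar>c\<bar> \<le> infdist y L"
    using ne by (auto simp: infdist_def intro!: cINF_greatest)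
  then show ?thesis using assms(2) by (simp add: field_simps)
qed

text \<open>The ratio of distance to norm is homogeneous, so it attains its maximum on the compact
  set of unit vectors of \<open>M + N\<close> for which 0 is nearest in \<open>N\<close>; there it is always below 1.
  The vectors of \<open>M + N\<close> are written as differences, the shape in which gaps occur.\<close>

lemma gap_contraction:
  fixes M N :: "'a::real_normed_vector set"
  assumes fd: "finite_dimensional_space TYPE('a)"
    and smooth: "smooth_space TYPE('a)" and M: "subspace M" and N: "subspace N"
  obtains q where "0 \<le> q" "q < 1"
    "\<And>u v. u \<in> M \<Longrightarrow> v \<in> N \<Longrightarrow> norm (u - v) \<le> infdist (u - v) N \<Longrightarrow>
       infdist (u - v) M \<le> q * norm (u - v)"
proof -
  define S where "S = {u + v | u v. u \<in> M \<and> v \<in> N}"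
  have S: "subspace S" unfolding S_def using M N by (rule subspace_sums)
  define K where "K = cball 0 1 \<inter> (S \<inter> {y. norm y = 1 \<and> norm y \<le> infdist y N})"
  have "closed {y::'a. norm y = 1 \<and> norm y \<le> infdist y N}"
    by (intro closed_Collect_conj closed_Collect_eq closed_Collect_le continuous_intros)
  then have K: "compact K"
    unfolding K_def
    by (intro compact_Int_closed closed_Int finite_dimensional_compact_cball[OF fd]
        finite_dimensional_closed_subspace[OF fd S])
  have lt1: "infdist y M < 1" if "y \<in> K" for y
  proof (rule ccontr)
    assume "\<not> ?thesis"
    with that have "norm y \<le> infdist y M" "norm y \<le> infdist y N" "norm y = 1" "y \<in> S"
      by (auto simp: K_def)
    then have "y = 0"
      using smooth_nearest_zero_both[OF smooth M N, of y] by (auto simp: S_def)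
    with \<open>norm y = 1\<close> show False by simp
  qed
  obtain q where q: "0 \<le> q" "q < 1" "\<And>y. y \<in> K \<Longrightarrow> infdist y M \<le> q"
  proof (cases "K = {}")
    case True
    then show ?thesis using that[of 0] by simp
  next
    case False
    then obtain y where "y \<in> K" "\<forall>z\<in>K. infdist z M \<le> infdist y M"
      using continuous_attains_sup[OF K, of "\<lambda>y. infdist y M"]
      by (force intro: continuous_intros)
    then show ?thesis using that[of "infdist y M"] lt1 infdist_nonneg by blast
  qed
  have "infdist (u - v) M \<le> q * norm (u - v)"
    if uv: "u \<in> M" "v \<in> N" "norm (u - v) \<le> infdist (u - v) N" for u v
  proof (cases "u = v")
    case True
    then show ?thesis using M by (simp add: subspace_0)
  next
    case False
    define r where "r = norm (u - v)"
    define y where "y = (1/r) *\<^sub>R (u - v)"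
    have r: "r > 0" using False by (simp add: r_def)
    have uvy: "u - v = r *\<^sub>R y" using r by (simp add: y_def)
    have "u - v \<in> S"
      using uv subspace_neg[OF N] by (force simp: S_def)
    then have "y \<in> S" unfolding y_def using S by (intro subspace_scale)
    moreover have "norm y = 1" using r by (simp add: y_def r_def)
    moreover have "norm y \<le> infdist y N"
    proof -
      have "r \<le> infdist (r *\<^sub>R y) N"
        using uv(3) by (simp flip: uvy r_def)
      also have "\<dots> \<le> r * infdist y N"
        using infdist_scaleR_subspace[OF N, of r y] r by simp
      finally have "r * 1 \<le> r * infdist y N" by simp
      then show ?thesis using r \<open>norm y = 1\<close> by (simp only: mult_le_cancel_left_pos)
    qed
    ultimately have "y \<in> K" by (simp add: K_def)
    then have "infdist y M \<le> q" by (rule q)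
    have "infdist (r *\<^sub>R y) M \<le> r * infdist y M"
      using infdist_scaleR_subspace[OF M, of r y] r by simp
    also have "\<dots> \<le> r * q"
      using r \<open>infdist y M \<le> q\<close> by simp
    finally show ?thesis
      by (simp flip: uvy r_def add: mult.commute)
  qed
  with q show ?thesis using that by blast
qed

section \<open>Convergence of alternating projections\<close>

lemma geometric_steps_convergent:
  fixes z :: "nat \<Rightarrow> 'a::banach"
  assumes "0 \<le> q" "q < 1" "\<And>n. norm (z (Suc n) - z n) \<le> C * q ^ n"
  shows "convergent z"
proof -
  have "summable (\<lambda>n. C * q ^ n)"
    using assms by (intro summable_mult summable_geometric) simp
  then have "summable (\<lambda>n. z (Suc n) - z n)"
    by (rule summable_comparison_test'[where N = 0]) (use assms in auto)
  then have "convergent (\<lambda>n. \<Sum>i<n. z (Suc i) - z i)"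
    by (simp add: summable_iff_convergent)
  then have "convergent (\<lambda>n. z n - z 0)"
    by (simp add: sum_lessThan_telescope)
  from convergent_add[OF this convergent_const[of "z 0"]] show ?thesis by simp
qed

lemma infdist_add_subspace:
  fixes L :: "'a::real_normed_vector set"
  assumes "subspace L" "w \<in> L"
  shows "infdist (y + w) L \<le> infdist y L"
proof -
  have ne: "L \<noteq> {}" using assms(2) by auto
  have "infdist (y + w) L \<le> dist y a" if "a \<in> L" for a
    using infdist_le[OF subspace_add[OF assms(1) that assms(2)], of "y + w"]
    by (simp add: dist_norm)
  then show ?thesis using ne by (auto simp: infdist_def[of y] intro!: cINF_greatest)
qed

text \<open>The gap contracts in the half step onto \<open>M\<close> and cannot grow in the half step onto \<open>N\<close>,
  since the previous point of \<open>N\<close> remains available. The start must be in \<open>M\<close> because the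
  contraction holds only for gaps in \<open>M + N\<close>.\<close>

lemma alternating_projections_converge_from_subspace:
  fixes M N :: "'a::banach set"
  assumes fd: "finite_dimensional_space TYPE('a)" and sc: "strictly_convex_space TYPE('a)"
    and smooth: "smooth_space TYPE('a)" and M: "subspace M" and N: "subspace N"
    and x: "x \<in> M"
  shows "\<exists>l\<in>M \<inter> N. (\<lambda>n. ((metric_proj M \<circ> metric_proj N) ^^ n) x) \<longlonglongrightarrow> l \<and>
     (\<lambda>n. metric_proj N (((metric_proj M \<circ> metric_proj N) ^^ n) x)) \<longlonglongrightarrow> l"
proof -
  define z where "z n = ((metric_proj M \<circ> metric_proj N) ^^ n) x" for n
  define w where "w n = metric_proj N (z n)" for n
  note inM = metric_proj_in[OF fd sc M] and inN = metric_proj_in[OF fd sc N]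
  have z_Suc: "z (Suc n) = metric_proj M (w n)" for n by (simp add: z_def w_def)
  have zM: "z n \<in> M" for n
    by (cases n) (use x inM in \<open>auto simp: z_def\<close>)
  have wN: "w n \<in> N" for n by (simp add: w_def inN)
  obtain q where q: "0 \<le> q" "q < 1"
    and contr: "\<And>u v. u \<in> M \<Longrightarrow> v \<in> N \<Longrightarrow> norm (u - v) \<le> infdist (u - v) N \<Longrightarrow>
       infdist (u - v) M \<le> q * norm (u - v)"
    using gap_contraction[OF fd smooth M N] by blast
  define g where "g n = norm (z n - w n)" for n
  have half: "norm (w n - z (Suc n)) \<le> q * g n" for n
  proof -
    have "norm (z n - w n) = infdist (z n) N"
      by (simp add: w_def norm_diff_metric_proj[OF fd sc N])
    also have "\<dots> \<le> infdist (z n - w n) N"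
      using infdist_add_subspace[OF N wN, of "z n - w n" n] by simp
    finally have "infdist (z n - w n) M \<le> q * g n"
      unfolding g_def using zM wN by (intro contr)
    moreover have "norm (w n - z (Suc n)) \<le> infdist (z n - w n) M"
    proof -
      have "norm (w n - z (Suc n)) = infdist (w n) M"
        by (simp add: z_Suc norm_diff_metric_proj[OF fd sc M])
      also have "\<dots> \<le> infdist ((-1) *\<^sub>R (z n - w n)) M"
        using infdist_add_subspace[OF M zM, of "w n - z n" n] by simp
      also have "\<dots> \<le> infdist (z n - w n) M"
        using infdist_scaleR_subspace[OF M, of "-1" "z n - w n"] by simp
      finally show ?thesis .
    qed
    ultimately show ?thesis by simp
  qed
  have gap: "g n \<le> g 0 * q ^ n" for n
  proof (induction n)
    case (Suc n)
    have "g (Suc n) \<le> norm (z (Suc n) - w n)"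
      unfolding g_def w_def[of "Suc n"] using metric_proj_best[OF fd sc N wN] .
    also have "\<dots> \<le> q * g n" using half by (simp add: norm_minus_commute)
    also have "\<dots> \<le> q * (g 0 * q ^ n)" using Suc q by (intro mult_left_mono)
    finally show ?case by (simp add: mult_ac)
  qed simp
  have "norm (z (Suc n) - z n) \<le> (2 * g 0) * q ^ n" for n
  proof -
    have "norm (z (Suc n) - z n) \<le> norm (w n - z (Suc n)) + norm (z n - w n)"
      using norm_triangle_ineq[of "z (Suc n) - w n" "w n - z n"]
      by (simp add: norm_minus_commute)
    also have "\<dots> \<le> q * g n + g n" using half[of n] by (simp add: g_def)
    also have "\<dots> \<le> g n + g n"
      using q mult_right_mono[of q 1 "g n"] by (simp add: g_def)
    finally show ?thesis using gap[of n] by simp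
  qed
  from geometric_steps_convergent[OF q this] obtain l where l: "z \<longlonglongrightarrow> l"
    by (auto simp: convergent_def)
  have "(\<lambda>n. g 0 * q ^ n) \<longlonglongrightarrow> 0"
    using q by (intro tendsto_mult_right_zero LIMSEQ_power_zero) simp
  then have "(\<lambda>n. z n - w n) \<longlonglongrightarrow> 0"
    by (rule Lim_null_comparison[rotated]) (use gap in \<open>simp add: g_def\<close>)
  from tendsto_diff[OF l this] have w: "w \<longlonglongrightarrow> l" by simp
  have "l \<in> M" "l \<in> N"
    using closed_sequentially[OF finite_dimensional_closed_subspace[OF fd M] _ l] zM
      closed_sequentially[OF finite_dimensional_closed_subspace[OF fd N] _ w] wN by auto
  with l w show ?thesis unfolding w_def z_def by blast
qed

lemma
  fixes M N :: "'a::banach set"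
  assumes fd: "finite_dimensional_space TYPE('a)" and sc: "strictly_convex_space TYPE('a)"
    and smooth: "smooth_space TYPE('a)" and M: "subspace M" and N: "subspace N"
  shows alt_proj_lim_in: "alt_proj_lim M N x \<in> M \<inter> N"
    and alternating_projections_tendsto:
      "(\<lambda>n. ((metric_proj M \<circ> metric_proj N) ^^ n) x) \<longlonglongrightarrow> alt_proj_lim M N x"
    and half_step_tendsto:
      "(\<lambda>n. metric_proj N (((metric_proj M \<circ> metric_proj N) ^^ n) x)) \<longlonglongrightarrow> alt_proj_lim M N x"
proof -
  let ?T = "metric_proj M \<circ> metric_proj N"
  \<comment> \<open>One step moves an arbitrary starting point into \<open>M\<close>.\<close>
  have "?T x \<in> M" using metric_proj_in[OF fd sc M] by simp
  then obtain l where l: "l \<in> M \<inter> N" "(\<lambda>n. (?T ^^ n) (?T x)) \<longlonglongrightarrow> l"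
    "(\<lambda>n. metric_proj N ((?T ^^ n) (?T x))) \<longlonglongrightarrow> l"
    using alternating_projections_converge_from_subspace[OF assms] by blast
  have shift: "(?T ^^ n) (?T x) = (?T ^^ Suc n) x" for n
    by (simp add: funpow_Suc_right del: funpow.simps)
  have lim: "(\<lambda>n. (?T ^^ n) x) \<longlonglongrightarrow> l"
    using l(2) unfolding shift by (rule LIMSEQ_imp_Suc)
  have half: "(\<lambda>n. metric_proj N ((?T ^^ n) x)) \<longlonglongrightarrow> l"
    using l(3) unfolding shift by (rule LIMSEQ_imp_Suc)
  have "alt_proj_lim M N x = l"
    unfolding alt_proj_lim_def using lim by (rule limI)
  then show "alt_proj_lim M N x \<in> M \<inter> N"
    "(\<lambda>n. (?T ^^ n) x) \<longlonglongrightarrow> alt_proj_lim M N x"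
    "(\<lambda>n. metric_proj N ((?T ^^ n) x)) \<longlonglongrightarrow> alt_proj_lim M N x"
    using l(1) lim half by (simp_all only:)
qed

section \<open>Limits of alternating projections and the projection onto the intersection\<close>

text \<open>The iterates of \<open>P\<^sub>M P\<^sub>N\<close> from \<open>P\<^sub>M x\<close> are the half steps of the iteration from \<open>x\<close> that
  starts with \<open>P\<^sub>M\<close>.\<close>

lemma alt_proj_lim_metric_proj:
  fixes M N :: "'a::banach set"
  assumes fd: "finite_dimensional_space TYPE('a)" and sc: "strictly_convex_space TYPE('a)"
    and smooth: "smooth_space TYPE('a)" and M: "subspace M" and N: "subspace N"
  shows "alt_proj_lim M N (metric_proj M x) = alt_proj_lim N M x"
proof -
  have "((metric_proj M \<circ> metric_proj N) ^^ n) (metric_proj M x) =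
      metric_proj M (((metric_proj N \<circ> metric_proj M) ^^ n) x)" for n
    by (induction n) auto
  then have "(\<lambda>n. ((metric_proj M \<circ> metric_proj N) ^^ n) (metric_proj M x))
      \<longlonglongrightarrow> alt_proj_lim N M x"
    using half_step_tendsto[OF fd sc smooth N M, of x] by (simp only:)
  with alternating_projections_tendsto[OF fd sc smooth M N] show ?thesis
    by (rule LIMSEQ_unique)
qed

lemma alt_proj_lim_add:
  fixes M N :: "'a::banach set"
  assumes fd: "finite_dimensional_space TYPE('a)" and sc: "strictly_convex_space TYPE('a)"
    and smooth: "smooth_space TYPE('a)" and M: "subspace M" and N: "subspace N"
    and w: "w \<in> M \<inter> N"
  shows "alt_proj_lim M N (x + w) = alt_proj_lim M N x + w"
proof -
  let ?T = "metric_proj M \<circ> metric_proj N"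
  have "(?T ^^ n) (x + w) = (?T ^^ n) x + w" for n
    by (induction n) (use w in \<open>auto simp: metric_proj_add[OF fd sc M] metric_proj_add[OF fd sc N]\<close>)
  then have "(\<lambda>n. (?T ^^ n) (x + w)) \<longlonglongrightarrow> alt_proj_lim M N x + w"
    using tendsto_add[OF alternating_projections_tendsto[OF fd sc smooth M N, of x] tendsto_const[of w]]
    by simp
  then show ?thesis
    unfolding alt_proj_lim_def[of M N "x + w"] by (rule limI)
qed

text \<open>The projection onto \<open>M \<inter> N\<close> is constant along the iterates, so the distance from the
  iterates to that constant point is their distance to \<open>M \<inter> N\<close>, which tends to 0.\<close>

lemma alt_proj_lim_eq_of_invariant:
  fixes M N :: "'a::banach set"
  assumes fd: "finite_dimensional_space TYPE('a)" and sc: "strictly_convex_space TYPE('a)"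
    and smooth: "smooth_space TYPE('a)" and M: "subspace M" and N: "subspace N"
    and invM: "\<And>x. metric_proj (M \<inter> N) (metric_proj M x) = metric_proj (M \<inter> N) x"
    and invN: "\<And>x. metric_proj (M \<inter> N) (metric_proj N x) = metric_proj (M \<inter> N) x"
  shows "alt_proj_lim M N x = metric_proj (M \<inter> N) x"
proof -
  let ?p = "metric_proj (M \<inter> N) x"
  have MN: "subspace (M \<inter> N)" using M N by (rule subspace_inter)
  define z where "z n = ((metric_proj M \<circ> metric_proj N) ^^ n) x" for n
  have z: "z \<longlonglongrightarrow> alt_proj_lim M N x"
    using alternating_projections_tendsto[OF fd sc smooth M N] unfolding z_def .
  have "metric_proj (M \<inter> N) (z n) = ?p" for n
    unfolding z_def by (induction n) (auto simp: invM invN)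
  then have "norm (z n - ?p) = infdist (z n) (M \<inter> N)" for n
    using norm_diff_metric_proj[OF fd sc MN, of "z n"] by simp
  moreover have "(\<lambda>n. infdist (z n) (M \<inter> N)) \<longlonglongrightarrow> 0"
    using tendsto_infdist[OF z, of "M \<inter> N"] alt_proj_lim_in[OF fd sc smooth M N, of x] by simp
  ultimately have "(\<lambda>n. norm (z n - ?p)) \<longlonglongrightarrow> 0"
    by (simp only:)
  then have "(\<lambda>n. z n - ?p) \<longlonglongrightarrow> 0"
    by (rule tendsto_norm_zero_cancel)
  then have "z \<longlonglongrightarrow> ?p" by (simp add: LIM_zero_iff)
  with z show ?thesis by (rule LIMSEQ_unique)
qed

text \<open>Apply the defining inequality of a \<open>B\<close>-operator to the points \<open>x - q\<close> with \<open>q \<in> M \<inter> N\<close>: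
  equivariance under translation gives \<open>\<parallel>x - R x\<parallel> \<le> \<parallel>x - q\<parallel>\<close>, so \<open>R x\<close> is the nearest point.\<close>

lemma alt_proj_lim_eq_of_B_operator:
  fixes M N :: "'a::banach set"
  assumes fd: "finite_dimensional_space TYPE('a)" and sc: "strictly_convex_space TYPE('a)"
    and smooth: "smooth_space TYPE('a)" and M: "subspace M" and N: "subspace N"
    and B: "B_operator (alt_proj_lim M N)"
  shows "alt_proj_lim M N = metric_proj (M \<inter> N)"
proof (rule ext, rule sym, rule metric_proj_eqI[OF fd sc subspace_inter[OF M N]])
  fix x q assume "q \<in> M \<inter> N"
  then have "- q \<in> M \<inter> N" using subspace_neg[OF subspace_inter[OF M N]] by blast
  then have "alt_proj_lim M N (x - q) = alt_proj_lim M N x - q"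
    using alt_proj_lim_add[OF fd sc smooth M N, of "- q" x] by simp
  moreover have "norm (x - q - alt_proj_lim M N (x - q)) \<le> norm (x - q)"
    using B by (auto simp: B_operator_def)
  ultimately show "norm (x - alt_proj_lim M N x) \<le> norm (x - q)" by simp
qed (rule alt_proj_lim_in[OF fd sc smooth M N])

text \<open>Subtracting \<open>P\<^sub>L x\<close> moves \<open>x\<close> into the kernel of \<open>P\<^sub>L\<close>, and since \<open>L \<subseteq> M\<close> both
  projections commute with this translation.\<close>

lemma metric_proj_invariant_of_ker:
  fixes L M :: "'a::real_normed_vector set"
  assumes fd: "finite_dimensional_space TYPE('a)" and sc: "strictly_convex_space TYPE('a)"
    and L: "subspace L" and M: "subspace M" and sub: "L \<subseteq> M"
    and ker: "metric_proj M ` op_ker (metric_proj L) \<subseteq> op_ker (metric_proj L)"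
  shows "metric_proj L (metric_proj M x) = metric_proj L x"
proof -
  define p where "p = metric_proj L x"
  have p: "- p \<in> L"
    unfolding p_def using metric_proj_in[OF fd sc L] L by (intro subspace_neg)
  then have "metric_proj L (x - p) = 0"
    using metric_proj_add[OF fd sc L p, of x] by (simp add: p_def)
  then have "metric_proj L (metric_proj M (x - p)) = 0"
    using ker by (auto simp: op_ker_def)
  moreover have "metric_proj M (x - p) = metric_proj M x - p"
    using metric_proj_add[OF fd sc M, of "- p" x] p sub by auto
  moreover have "metric_proj L (metric_proj M x - p) = metric_proj L (metric_proj M x) - p"
    using metric_proj_add[OF fd sc L p, of "metric_proj M x"] by simp
  ultimately show ?thesis by (simp add: p_def)
qed

theorem theorem2p9:
  fixes M N :: "'a::banach set"
  assumes "finite_dimensional_space TYPE('a)"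
    and "strictly_convex_space TYPE('a)"
    and "smooth_space TYPE('a)"
    and "subspace M" and "subspace N"
  defines "S1 \<equiv> alt_proj_lim M N = metric_proj (M \<inter> N) \<and>
                alt_proj_lim N M = metric_proj (M \<inter> N)"
    and "S2 \<equiv> metric_proj (M \<inter> N) \<circ> metric_proj M = metric_proj (M \<inter> N) \<and>
              metric_proj (M \<inter> N) \<circ> metric_proj N = metric_proj (M \<inter> N)"
    and "S3 \<equiv> metric_proj M ` op_ker (metric_proj (M \<inter> N)) \<subseteq> op_ker (metric_proj (M \<inter> N)) \<and>
              metric_proj N ` op_ker (metric_proj (M \<inter> N)) \<subseteq> op_ker (metric_proj (M \<inter> N))"
    and "S4 \<equiv> B_operator (alt_proj_lim M N) \<and> B_operator (alt_proj_lim N M)"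
  shows "(S1 \<longleftrightarrow> S2) \<and> (S2 \<longleftrightarrow> S3) \<and> (S3 \<longleftrightarrow> S4)"
proof -
  note fd = assms(1) and sc = assms(2) and smooth = assms(3) and M = assms(4) and N = assms(5)
  have MN: "subspace (M \<inter> N)" using M N by (rule subspace_inter)
  have "S2" if S1
    using that alt_proj_lim_metric_proj[OF fd sc smooth M N]
      alt_proj_lim_metric_proj[OF fd sc smooth N M]
    by (auto simp: S1_def S2_def fun_eq_iff)
  moreover have "S1" if S2
    using that alt_proj_lim_eq_of_invariant[OF fd sc smooth M N]
      alt_proj_lim_eq_of_invariant[OF fd sc smooth N M]
    by (auto simp: S1_def S2_def fun_eq_iff Int_commute)
  moreover have "S3" if S2
    using that by (auto simp: S2_def S3_def op_ker_def fun_eq_iff)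
  moreover have "S2" if S3
    using that metric_proj_invariant_of_ker[OF fd sc MN M]
      metric_proj_invariant_of_ker[OF fd sc MN N]
    by (auto simp: S2_def S3_def fun_eq_iff)
  moreover have "S4" if S1
    using that metric_proj_B_operator[OF fd sc MN] by (simp add: S1_def S4_def)
  moreover have "S1" if S4
    using that alt_proj_lim_eq_of_B_operator[OF fd sc smooth M N]
      alt_proj_lim_eq_of_B_operator[OF fd sc smooth N M]
    by (simp add: S1_def S4_def Int_commute)
  ultimately show ?thesis by blast
qed

end
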